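(* Let $\sigma>0$ and let $Z$ be a real random variable with normal distribution of mean $0$ and standard deviation $\sigma$. Then for every $s\in\mathbb{R}$, the $s$-th bit of $Z$ is significant with probability $$p_s = 2F\!\left(\frac{2^{-s}}{\sigma}\right)-1,$$ that is, $\mathbb{P}\left(|Z|<2^{-s}\right)=2F\!\left(\frac{2^{-s}}{\sigma}\right)-1$, where $F$ is the cumulative distribution function of the normal distribution with mean $0$ and variance $1$.
   Context: $Z$ models the (absolute or relative) error of a stochastic floating-point computation. The probability that the $s$-th bit of $Z$ is significant is by definition $\mathbb{P}(|Z|<2^{-s})$. *)

theory Defs
  imports "HOL-Probability.Probability"
begin

text \<open>
  The bit index \<open>s\<close> ranges over the reals, hence \<open>powr\<close>.
\<close>

definition prob_bit_significant :: "'a measure \<Rightarrow> ('a \<Rightarrow> real) \<Rightarrow> real \<Rightarrow> real" where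
  "prob_bit_significant M Z s = measure M {\<omega> \<in> space M. \<bar>Z \<omega>\<bar> < 2 powr (- s)}"

end

theory Submission
  imports Defs
begin

text \<open>
  Dividing by \<open>\<sigma>\<close> turns \<open>Z\<close> into a standard normal variable, and \<open>\<bar>Z\<bar> < 2 powr (- s)\<close> into
  \<open>\<bar>Z / \<sigma>\<bar> < a\<close> with \<open>a = 2 powr (- s) / \<sigma>\<close>.
  The complement of this event consists of the two tails \<open>{..-a}\<close> and \<open>{a..}\<close>. They have equal
  mass, because the standard normal law is invariant under \<open>x \<mapsto> - x\<close>, and each has mass
  \<open>1 - F a\<close>, because that law has no atom at \<open>a\<close>. Hence the event has probability
  \<open>1 - 2 * (1 - F a)\<close>, which is \<open>2 * F a - 1\<close>. The tail argument is a fact about any symmetric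
  law without an atom at \<open>a\<close>, stated as \<open>measure_symmetric_interval\<close>.
\<close>

lemma (in real_distribution) measure_symmetric_interval:
  assumes sym: "distr M borel uminus = M"
    and no_atom: "measure M {a} = 0"
    and "0 < a"
  shows "measure M {-a<..<a} = 2 * cdf M a - 1"
proof -
  have "measure M {..-a} = measure (distr M borel uminus) {..-a}"
    by (simp add: sym)
  also have "\<dots> = measure M (uminus -` {..-a} \<inter> space M)"
    by (rule measure_distr) auto
  also have "uminus -` {..-a} \<inter> space M = {a..}"
    by auto
  finally have tails: "measure M {..-a} = measure M {a..}" .

  have "prob (space M - {a<..}) = 1 - prob {a<..}"
    by (rule prob_compl) auto
  moreover have "space M - {a<..} = {..a}"
    by auto
  moreover have "prob ({a} \<union> {a<..}) = prob {a} + prob {a<..}"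
    by (rule finite_measure_Union) auto
  moreover have "{a} \<union> {a<..} = {a..}"
    by auto
  ultimately have tail: "prob {a..} = 1 - cdf M a"
    using no_atom by (simp add: cdf_def2)

  have "prob (space M - ({..-a} \<union> {a..})) = 1 - prob ({..-a} \<union> {a..})"
    by (rule prob_compl) auto
  moreover have "space M - ({..-a} \<union> {a..}) = {-a<..<a}"
    by auto
  moreover have "prob ({..-a} \<union> {a..}) = prob {..-a} + prob {a..}"
    by (rule finite_measure_Union) (use \<open>0 < a\<close> in auto)
  ultimately show ?thesis
    using tails tail by simp
qed

text \<open>
  Under the standard normal law the identity is a standard normal variable, so affine
  invariance of normal variables with factor \<open>- 1\<close> gives the law of \<open>x \<mapsto> - x\<close>.
\<close>

lemma std_normal_distribution_symmetric:
  "distr std_normal_distribution borel uminus = std_normal_distribution"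
proof -
  interpret N: real_distribution std_normal_distribution
    by (rule real_dist_normal_dist)
  have "distr std_normal_distribution lborel (\<lambda>x. x) = std_normal_distribution"
    by (rule distr_id2) simp
  then have "distributed std_normal_distribution lborel (\<lambda>x. x) std_normal_density"
    by (simp add: distributed_def)
  from N.normal_density_affine[OF this, of "-1" 0]
  have "distributed std_normal_distribution lborel uminus std_normal_density"
    by simp
  then have "distr std_normal_distribution lborel uminus = std_normal_distribution"
    by (rule distributed_distr_eq_density)
  moreover have "distr std_normal_distribution borel uminus
      = distr std_normal_distribution lborel uminus"
    by (rule distr_cong) auto
  ultimately show ?thesis
    by simp
qed

lemma std_normal_distribution_no_atom:
  "measure std_normal_distribution {x} = 0"
proof -
  have "{x} \<in> null_sets std_normal_distribution"
    by (rule absolutely_continuousI_density[unfolded absolutely_continuous_def, THEN subsetD]) auto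
  then show ?thesis
    by (simp add: measure_def null_setsD1)
qed

theorem theorem1:
  fixes M :: "'a measure" and Z :: "'a \<Rightarrow> real" and \<sigma> s :: real
  assumes "prob_space M"
    and "\<sigma> > 0"
    and "distributed M lborel Z (normal_density 0 \<sigma>)"
  shows "prob_bit_significant M Z s = 2 * cdf std_normal_distribution (2 powr (- s) / \<sigma>) - 1"
proof -
  interpret prob_space M by fact
  interpret N: real_distribution std_normal_distribution
    by (rule real_dist_normal_dist)
  define a where "a = 2 powr (- s) / \<sigma>"
  have "0 < a"
    using \<open>\<sigma> > 0\<close> by (simp add: a_def)
  have std: "distributed M lborel (\<lambda>\<omega>. Z \<omega> / \<sigma>) std_normal_density"
    using assms(3) normal_standard_normal_convert[OF \<open>\<sigma> > 0\<close>, of Z 0] by simp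
  have "{\<omega> \<in> space M. \<bar>Z \<omega>\<bar> < 2 powr (- s)} = (\<lambda>\<omega>. Z \<omega> / \<sigma>) -` {-a<..<a} \<inter> space M"
    using \<open>\<sigma> > 0\<close> by (auto simp: a_def field_simps abs_less_iff)
  then have "prob_bit_significant M Z s = prob ((\<lambda>\<omega>. Z \<omega> / \<sigma>) -` {-a<..<a} \<inter> space M)"
    by (simp add: prob_bit_significant_def)
  also have "\<dots> = measure (distr M lborel (\<lambda>\<omega>. Z \<omega> / \<sigma>)) {-a<..<a}"
    by (rule measure_distr[symmetric]) (use distributed_measurable[OF std] in auto)
  also have "\<dots> = measure std_normal_distribution {-a<..<a}"
    by (simp add: distributed_distr_eq_density[OF std])
  also have "\<dots> = 2 * cdf std_normal_distribution a - 1"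
    by (rule N.measure_symmetric_interval[OF std_normal_distribution_symmetric
          std_normal_distribution_no_atom \<open>0 < a\<close>])
  finally show ?thesis
    by (simp add: a_def)
qed

end
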